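(* If $k\ge N_{\mathcal P}$ and $\|x_k-x^*\|\le\frac{2\alpha_k\delta_3}{1-\epsilon+\alpha_kL}$, then HSPG yields $\mathcal I^0(x^* )\subseteq\mathcal I^0(x_{k+1})$.
   Context: Problem: $\min_{x\in\mathbb R^n}\Psi(x):=f(x)+\lambda\Omega(x)$, $f(x)=\frac1N\sum_{i=1}^N f_i(x)$, $f_i:\mathbb R^n\to\mathbb R$, $\lambda>0$, $\Omega(x)=\sum_{g\in\mathcal G}\|[x]_g\|$, where $\mathcal G$ is a fixed partition of $\{1,\dots,n\}$, $[x]_g$ is the subvector of $x$ indexed by $g$, and $\|\cdot\|$ is the $\ell_2$-norm. For a mini-batch $\mathcal B\subseteq\{1,\dots,N\}$, $f_{\mathcal B}=\frac1{|\mathcal B|}\sum_{i\in\mathcal B}f_i$ and $\Psi_{\mathcal B}=f_{\mathcal B}+\lambda\Omega$. Put $\mathcal I^0(x)=\{g\in\mathcal G:[x]_g=0\}$, $\mathcal I^{\ne0}(x)=\{g\in\mathcal G:[x]_g\ne0\}$. For $g\in\mathcal I^{\neq0}(x)$, $[\nabla\Psi_{\mathcal B}(x)]_g=[\nabla f_{\mathcal B}(x)]_g+\lambda[x]_g/\|[x]_g\|$. HSPG algorithm (parameters $\epsilon\in[0,1)$, $N_{\mathcal P}\in\mathbb Z^+$, step sizes $\alpha_k>0$, mini-batches $\mathcal B_k$): for $k<N_{\mathcal P}$ it performs proximal stochastic gradient steps; for $k\ge N_{\mathcal P}$ it performs a Half-Space Step: set $[\tilde x_{k+1}]_g=[x_k]_g-\alpha_k[\nabla\Psi_{\mathcal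 B_k}(x_k)]_g$ for $g\in\mathcal I^{\ne0}(x_k)$ and $[\tilde x_{k+1}]_g=0$ for $g\in\mathcal I^0(x_k)$; then for each $g\in\mathcal I^{\ne0}(x_k)$ set $[x_{k+1}]_g=0$ if $[\tilde x_{k+1}]_g^\top[x_k]_g<\epsilon\|[x_k]_g\|^2$ and $[x_{k+1}]_g=[\tilde x_{k+1}]_g$ otherwise; $[x_{k+1}]_g=0$ for $g\in\mathcal I^0(x_k)$. Standing assumptions: each $f_i$ is differentiable, bounded below, with $L$-Lipschitz gradient (so $\nabla f_{\mathcal B}$ is $L$-Lipschitz for every $\mathcal B$). $x^*$ is a local minimizer of $\Psi$ with group sparsity; the least and largest norms of nonzero groups of $x^*$ are $2\delta_1>0$ and $2\delta_2>0$; and, with a common $\delta_3$ for all mini-batches $\mathcal B$, $0<2\delta_3:=\min_{g\in\mathcal I^0(x^* )}(\lambda-\|[\nabla f_{\mathcal B}(x^* )]_g\|)$, i.e. $\|[\nabla f_{\mathcal B}(x^* )]_g\|\le\lambda-2\delta_3$ for all $g\in\mathcal I^0(x^* )$ and all $\mathcal B$.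
   Formalization: When ε > 0 the equality case ‖x_k − x*‖ = 2α_kδ_3/(1−ε+α_kL) is excluded, because the strict half-space test may then hold with equality and keep the group; for ε = 0 equality is allowed as stated. *)

theory Defs
  imports "HOL-Analysis.Analysis" "HOL-Library.Disjoint_Sets"
begin

definition grad :: "('a::real_inner \<Rightarrow> real) \<Rightarrow> 'a \<Rightarrow> 'a" where
  "grad h x = (THE D. GDERIV h x :> D)"

text \<open>
  The subvector of \<open>x\<close> indexed by \<open>g\<close>, padded with zeros outside \<open>g\<close> so that subvectors for
  different groups share one type. Padding preserves sums, scalar multiples, inner products of
  subvectors with the same index set, and the Euclidean norm.
\<close>

definition subvec :: "real ^ 'n \<Rightarrow> 'n set \<Rightarrow> real ^ 'n" where
  "subvec x g = (\<chi> i. if i \<in> g then x $ i else 0)"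

definition Omega :: "'n::finite set set \<Rightarrow> real ^ 'n \<Rightarrow> real" where
  "Omega G x = (\<Sum>g\<in>G. norm (subvec x g))"

definition zero_groups :: "'n set set \<Rightarrow> real ^ 'n \<Rightarrow> 'n set set" where
  "zero_groups G x = {g \<in> G. subvec x g = 0}"

definition nonzero_groups :: "'n set set \<Rightarrow> real ^ 'n \<Rightarrow> 'n set set" where
  "nonzero_groups G x = {g \<in> G. subvec x g \<noteq> 0}"

definition minibatch :: "nat \<Rightarrow> nat set \<Rightarrow> bool" where
  "minibatch N B \<longleftrightarrow> B \<subseteq> {1..N} \<and> B \<noteq> {}"

definition batch_fun :: "(nat \<Rightarrow> 'a \<Rightarrow> real) \<Rightarrow> nat set \<Rightarrow> 'a \<Rightarrow> real" where
  "batch_fun f B x = (1 / real (card B)) * (\<Sum>i\<in>B. f i x)"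

definition Psi :: "'n::finite set set \<Rightarrow> real \<Rightarrow> (nat \<Rightarrow> real ^ 'n \<Rightarrow> real) \<Rightarrow> nat set \<Rightarrow> real ^ 'n \<Rightarrow> real" where
  "Psi G lam f B x = batch_fun f B x + lam * Omega G x"

definition local_minimizer :: "('a::metric_space \<Rightarrow> real) \<Rightarrow> 'a \<Rightarrow> bool" where
  "local_minimizer h x \<longleftrightarrow> (\<exists>r>0. \<forall>y\<in>ball x r. h x \<le> h y)"

text \<open>
  The \<open>g\<close>-block of the gradient of \<open>Psi\<close> for the mini-batch \<open>B\<close>; meaningful only if
  \<open>subvec x g \<noteq> 0\<close>.
\<close>

definition grad_Psi_group ::
    "real \<Rightarrow> (nat \<Rightarrow> real ^ 'n \<Rightarrow> real) \<Rightarrow> nat set \<Rightarrow> real ^ 'n \<Rightarrow> 'n::finite set \<Rightarrow> real ^ 'n" where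
  "grad_Psi_group lam f B x g =
     subvec (grad (batch_fun f B) x) g + (lam / norm (subvec x g)) *\<^sub>R subvec x g"

text \<open>
  One proximal stochastic gradient step from \<open>x\<close> to \<open>x'\<close>: \<open>x'\<close> is the proximal point, for
  \<open>a * lam * Omega\<close>, of the plain stochastic gradient step.
\<close>

definition prox_sg_step ::
    "'n::finite set set \<Rightarrow> real \<Rightarrow> (nat \<Rightarrow> real ^ 'n \<Rightarrow> real) \<Rightarrow> real \<Rightarrow> nat set \<Rightarrow> real ^ 'n \<Rightarrow> real ^ 'n \<Rightarrow> bool" where
  "prox_sg_step G lam f a B x x' \<longleftrightarrow>
     is_arg_min
       (\<lambda>y. 1 / (2 * a) * (norm (y - (x - a *\<^sub>R grad (batch_fun f B) x)))\<^sup>2 + lam * Omega G y)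
       (\<lambda>y. True) x'"

definition half_space_step ::
    "'n::finite set set \<Rightarrow> real \<Rightarrow> (nat \<Rightarrow> real ^ 'n \<Rightarrow> real) \<Rightarrow> real \<Rightarrow> real \<Rightarrow> nat set \<Rightarrow> real ^ 'n \<Rightarrow> real ^ 'n \<Rightarrow> bool" where
  "half_space_step G lam f eps a B x x' \<longleftrightarrow>
     (\<exists>xt.
        (\<forall>g\<in>nonzero_groups G x. subvec xt g = subvec x g - a *\<^sub>R grad_Psi_group lam f B x g) \<and>
        (\<forall>g\<in>zero_groups G x. subvec xt g = 0) \<and>
        (\<forall>g\<in>nonzero_groups G x.
           subvec x' g =
             (if subvec xt g \<bullet> subvec x g < eps * (norm (subvec x g))\<^sup>2 then 0 else subvec xt g)) \<and>
        (\<forall>g\<in>zero_groups G x. subvec x' g = 0))"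

definition hspg ::
    "'n::finite set set \<Rightarrow> real \<Rightarrow> (nat \<Rightarrow> real ^ 'n \<Rightarrow> real) \<Rightarrow> real \<Rightarrow> nat \<Rightarrow> (nat \<Rightarrow> real) \<Rightarrow> (nat \<Rightarrow> nat set)
      \<Rightarrow> (nat \<Rightarrow> real ^ 'n) \<Rightarrow> bool" where
  "hspg G lam f eps NP alpha B x \<longleftrightarrow>
     (\<forall>k. if k < NP then prox_sg_step G lam f (alpha k) (B k) (x k) (x (Suc k))
          else half_space_step G lam f eps (alpha k) (B k) (x k) (x (Suc k)))"

end

theory Submission
  imports Defs
begin

text \<open>
  The claim is checked one group at a time. Let \<open>g\<close> be a zero group of \<open>x\<^sup>*\<close>, and suppose that
  \<open>v = [x\<^sub>k]\<^sub>g\<close> is nonzero. Write \<open>d = \<parallel>x\<^sub>k - x\<^sup>*\<parallel>\<close>, \<open>a = \<alpha>\<^sub>k\<close>, and let \<open>w\<close> be the block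
  \<open>[\<nabla>f\<^sub>B(x\<^sub>k)]\<^sub>g\<close>. Since \<open>[x\<^sup>*]\<^sub>g = 0\<close>, the distance controls the block itself, \<open>\<parallel>v\<parallel> \<le> d\<close>, and
  the Lipschitz gradient gives \<open>\<parallel>w\<parallel> \<le> \<lambda> - 2\<delta>\<^sub>3 + L d\<close>. The radius in the theorem is exactly the
  one for which these two bounds combine to

    \<open>(1 - \<epsilon>) \<parallel>v\<parallel> + a \<parallel>w\<parallel> \<le> a \<lambda>\<close>.

  By Cauchy-Schwarz the trial block \<open>t = v - a (w + \<lambda> v / \<parallel>v\<parallel>)\<close> satisfies
  \<open>t \<bullet> v \<le> \<parallel>v\<parallel> (\<parallel>v\<parallel> + a \<parallel>w\<parallel> - a \<lambda>) \<le> \<epsilon> \<parallel>v\<parallel>\<^sup>2\<close>. If the last step is strict, the half-space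
  test projects the group to zero; for \<open>\<epsilon> > 0\<close> this is the case because \<open>x\<^sub>k\<close> lies strictly
  inside the radius. For \<open>\<epsilon> = 0\<close> the last step may be an equality, and a trial block
  with \<open>t \<bullet> v = 0\<close> survives the test; but equality in Cauchy-Schwarz then makes \<open>t\<close> itself vanish,
  so the new block is zero all the same. Lemma \<open>trial_block_rejected_or_zero\<close> contains this
  dichotomy. The remaining lemmas supply the Lipschitz bound on mini-batch gradients and the behaviour
  of subvectors.
\<close>

lemma GDERIV_grad:
  fixes h :: "'a::euclidean_space \<Rightarrow> real"
  assumes "h differentiable (at x)"
  shows "GDERIV h x :> grad h x"
proof -
  obtain h' where h': "(h has_derivative h') (at x)"
    using assms by (auto simp: differentiable_def)
  \<comment> \<open>The gradient is the Riesz representative of the derivative.\<close>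
  have "h' = (\<lambda>y. inner y (adjoint h' 1))"
    using adjoint_works[OF has_derivative_linear[OF h'], of _ 1] by (simp add: fun_eq_iff)
  with h' have D: "GDERIV h x :> adjoint h' 1"
    by (simp add: gderiv_def)
  moreover have "D' = adjoint h' 1" if "GDERIV h x :> D'" for D'
  proof -
    have "(\<lambda>y. inner y D') = (\<lambda>y. inner y (adjoint h' 1))"
      using that D unfolding gderiv_def by (rule has_derivative_unique)
    then show ?thesis
      by (metis vector_eq_ldot)
  qed
  ultimately show ?thesis
    unfolding grad_def by (rule theI)
qed

lemma grad_eqI:
  assumes "GDERIV h x :> D"
  shows "grad h x = D"
proof -
  have "D' = D" if "GDERIV h x :> D'" for D'
    using has_derivative_unique[OF that[unfolded gderiv_def] assms[unfolded gderiv_def]]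
    by (metis vector_eq_ldot)
  then show ?thesis
    unfolding grad_def using assms by blast
qed

lemma grad_batch_fun:
  fixes f :: "nat \<Rightarrow> 'a::euclidean_space \<Rightarrow> real"
  assumes "\<And>i. i \<in> C \<Longrightarrow> f i differentiable (at x)"
  shows "grad (batch_fun f C) x = (1 / real (card C)) *\<^sub>R (\<Sum>i\<in>C. grad (f i) x)"
proof (rule grad_eqI)
  have "((\<lambda>y. (1 / real (card C)) * (\<Sum>i\<in>C. f i y)) has_derivative
      (\<lambda>y. (1 / real (card C)) * (\<Sum>i\<in>C. inner y (grad (f i) x)))) (at x)"
    by (intro has_derivative_mult_right has_derivative_sum)
       (use GDERIV_grad assms in \<open>auto simp: gderiv_def\<close>)
  then show "GDERIV (batch_fun f C) x :> (1 / real (card C)) *\<^sub>R (\<Sum>i\<in>C. grad (f i) x)"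
    by (simp add: gderiv_def batch_fun_def[abs_def] inner_sum_right)
qed

text \<open>
  The mean of \<open>L\<close>-Lipschitz maps keeps the constant \<open>L\<close>, so one radius serves every mini-batch.
\<close>

lemma grad_batch_fun_lipschitz:
  fixes f :: "nat \<Rightarrow> 'a::euclidean_space \<Rightarrow> real"
  assumes C: "finite C" "C \<noteq> {}"
    and diff: "\<And>i y. i \<in> C \<Longrightarrow> f i differentiable (at y)"
    and lip: "\<And>i. i \<in> C \<Longrightarrow> L-lipschitz_on UNIV (grad (f i))"
  shows "norm (grad (batch_fun f C) x - grad (batch_fun f C) y) \<le> L * norm (x - y)"
proof -
  have card: "real (card C) > 0"
    using C by (simp add: card_gt_0_iff)
  have "norm (\<Sum>i\<in>C. grad (f i) x - grad (f i) y) \<le> (\<Sum>i\<in>C. L * norm (x - y))"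
    using lipschitz_onD[OF lip] by (intro sum_norm_le) (auto simp: dist_norm)
  then have "norm (\<Sum>i\<in>C. grad (f i) x - grad (f i) y) \<le> real (card C) * (L * norm (x - y))"
    by simp
  moreover have "grad (batch_fun f C) x - grad (batch_fun f C) y =
      (1 / real (card C)) *\<^sub>R (\<Sum>i\<in>C. grad (f i) x - grad (f i) y)"
    using diff by (simp add: grad_batch_fun sum_subtractf scaleR_diff_right)
  ultimately show ?thesis
    using card by (simp add: field_simps)
qed

lemma subvec_diff: "subvec (x - y) g = subvec x g - subvec y g"
  by (simp add: subvec_def vec_eq_iff)

lemma norm_subvec_le: "norm (subvec (x :: real ^ 'n::finite) g) \<le> norm x"
  by (rule norm_le_componentwise_cart) (simp add: subvec_def)

text \<open>
  The dichotomy behind the half-space test, for a trial block \<open>t\<close> obtained from \<open>v\<close> with smooth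
  gradient \<open>w\<close>. Write \<open>s = a \<lambda> - \<parallel>v\<parallel>\<close>, so that \<open>t + s v / \<parallel>v\<parallel> = - a w\<close>. If \<open>\<epsilon> = 0\<close>, the vector
  on the right lies in the ball of radius \<open>s\<close>; if moreover \<open>t \<bullet> v \<ge> 0\<close>, then the vector on the
  left has squared norm at least \<open>s\<^sup>2 + \<parallel>t\<parallel>\<^sup>2\<close>. Together these force \<open>t = 0\<close>.
\<close>

lemma trial_block_rejected_or_zero:
  fixes v w :: "'a::real_inner"
  assumes v: "v \<noteq> 0" and a: "a > 0" and eps: "eps \<ge> 0"
    and bound: "(1 - eps) * norm v + a * norm w \<le> a * lam"
    and strict: "eps > 0 \<Longrightarrow> (1 - eps) * norm v + a * norm w < a * lam"
  defines "t \<equiv> v - a *\<^sub>R (w + (lam / norm v) *\<^sub>R v)"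
  shows "t \<bullet> v < eps * (norm v)\<^sup>2 \<or> t = 0"
proof (cases "eps > 0")
  case True
  have "t \<bullet> v = (norm v)\<^sup>2 - a * (w \<bullet> v) - a * lam * norm v"
    using v unfolding t_def
    by (simp add: inner_diff_left inner_add_left dot_square_norm power2_eq_square field_simps)
  also have "\<dots> \<le> (norm v)\<^sup>2 + a * (norm w * norm v) - a * lam * norm v"
  proof -
    have "- (w \<bullet> v) \<le> norm w * norm v"
      using Cauchy_Schwarz_ineq2[of w v] by linarith
    from mult_left_mono[OF this, of a] a show ?thesis by simp
  qed
  also have "\<dots> = eps * (norm v)\<^sup>2 + norm v * ((1 - eps) * norm v + a * norm w - a * lam)"
    by (simp add: algebra_simps power2_eq_square)
  also have "\<dots> < eps * (norm v)\<^sup>2"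
    using strict[OF True] v by (simp add: mult_pos_neg)
  finally show ?thesis ..
next
  case False
  with eps have eps0: "eps = 0" by simp
  define s where "s = a * lam - norm v"
  have s: "a * norm w \<le> s"
    using bound eps0 by (simp add: s_def)
  have "0 \<le> a * norm w"
    using a by simp
  with s have s0: "0 \<le> s" by linarith
  have "t + (s / norm v) *\<^sub>R v = - (a *\<^sub>R w)"
    using v unfolding t_def s_def
    by (simp add: scaleR_add_right diff_divide_distrib scaleR_diff_left)
  then have "(norm (t + (s / norm v) *\<^sub>R v))\<^sup>2 = (a * norm w)\<^sup>2"
    using a by simp
  also have "\<dots> \<le> s\<^sup>2"
    using s a by (intro power_mono) auto
  finally have "(norm (t + (s / norm v) *\<^sub>R v))\<^sup>2 \<le> s\<^sup>2" .
  moreover have "(norm (t + (s / norm v) *\<^sub>R v))\<^sup>2 = (norm t)\<^sup>2 + 2 * (s / norm v) * (t \<bullet> v) + s\<^sup>2"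
  proof -
    have "(norm (t + c *\<^sub>R v))\<^sup>2 = (norm t)\<^sup>2 + 2 * c * (t \<bullet> v) + (c * norm v)\<^sup>2" for c
      unfolding power_mult_distrib power2_norm_eq_inner
      by (simp add: inner_add_left inner_add_right inner_commute[of v t] power2_eq_square algebra_simps)
    from this[of "s / norm v"] show ?thesis
      using v by simp
  qed
  ultimately have "(norm t)\<^sup>2 + 2 * (s / norm v) * (t \<bullet> v) + s\<^sup>2 \<le> s\<^sup>2"
    by simp
  moreover have "2 * (s / norm v) * (t \<bullet> v) \<ge> 0" if "t \<bullet> v \<ge> 0"
    using that s0 by simp
  ultimately have "t = 0" if "t \<bullet> v \<ge> 0"
    using that by (smt (verit) zero_less_norm_iff zero_less_power)
  then show ?thesis
    using eps0 by force
qed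

lemma half_space_step_zeroes_group:
  assumes step: "half_space_step G lam f eps a C x x'"
    and g: "g \<in> G" and a: "a > 0" and eps: "eps \<ge> 0"
    and bound: "(1 - eps) * norm (subvec x g) + a * norm (subvec (grad (batch_fun f C) x) g) \<le> a * lam"
    and strict: "eps > 0 \<Longrightarrow>
      (1 - eps) * norm (subvec x g) + a * norm (subvec (grad (batch_fun f C) x) g) < a * lam"
  shows "subvec x' g = 0"
proof (cases "subvec x g = 0")
  case True
  then show ?thesis
    using step g by (auto simp: half_space_step_def zero_groups_def)
next
  case False
  obtain t where
    t: "t = subvec x g - a *\<^sub>R grad_Psi_group lam f C x g" and
    x': "subvec x' g = (if t \<bullet> subvec x g < eps * (norm (subvec x g))\<^sup>2 then 0 else t)"
    using step g False by (auto simp: half_space_step_def nonzero_groups_def)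
  show ?thesis
    using trial_block_rejected_or_zero[OF False a eps bound strict] x'
    by (auto simp: t grad_Psi_group_def)
qed

(* The assumption "not_tie" excludes only the case eps > 0 with equality in "close". There the
   half-space test can hold with equality, so that its strict inequality fails and the group is
   kept. *)
theorem theorem2:
  fixes G :: "'n::finite set set"
    and f :: "nat \<Rightarrow> real ^ 'n \<Rightarrow> real"
    and N NP k :: nat
    and lam L eps delta1 delta2 delta3 :: real
    and alpha :: "nat \<Rightarrow> real"
    and B :: "nat \<Rightarrow> nat set"
    and x :: "nat \<Rightarrow> real ^ 'n"
    and xstar :: "real ^ 'n"
  assumes partition: "partition_on UNIV G"
    and N: "N \<ge> 1"
    and lam: "lam > 0"
    and differentiable: "\<And>i y. i \<in> {1..N} \<Longrightarrow> f i differentiable (at y)"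
    and bounded_below: "\<And>i. i \<in> {1..N} \<Longrightarrow> bdd_below (range (f i))"
    and lipschitz: "\<And>i. i \<in> {1..N} \<Longrightarrow> L-lipschitz_on UNIV (grad (f i))"
    and eps: "0 \<le> eps" "eps < 1"
    and NP: "NP \<ge> 1"
    and alpha: "\<And>j. alpha j > 0"
    and batches: "\<And>j. minibatch N (B j)"
    and run: "hspg G lam f eps NP alpha B x"
    and minimizer: "local_minimizer (Psi G lam f {1..N}) xstar"
    and sparse: "zero_groups G xstar \<noteq> {}"
    and delta1: "delta1 > 0"
      "nonzero_groups G xstar \<noteq> {} \<Longrightarrow>
         2 * delta1 = Min ((\<lambda>g. norm (subvec xstar g)) ` nonzero_groups G xstar)"
    and delta2: "delta2 > 0"
      "nonzero_groups G xstar \<noteq> {} \<Longrightarrow>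
         2 * delta2 = Max ((\<lambda>g. norm (subvec xstar g)) ` nonzero_groups G xstar)"
    and delta3: "delta3 > 0"
      "\<And>C g. minibatch N C \<Longrightarrow> g \<in> zero_groups G xstar \<Longrightarrow>
         norm (subvec (grad (batch_fun f C) xstar) g) \<le> lam - 2 * delta3"
    and k: "k \<ge> NP"
    and close: "norm (x k - xstar) \<le> 2 * alpha k * delta3 / (1 - eps + alpha k * L)"
    and not_tie: "eps > 0 \<Longrightarrow> norm (x k - xstar) \<noteq> 2 * alpha k * delta3 / (1 - eps + alpha k * L)"
  shows "zero_groups G xstar \<subseteq> zero_groups G (x (Suc k))"
proof
  fix g assume g: "g \<in> zero_groups G xstar"
  then have gG: "g \<in> G" and star: "subvec xstar g = 0"
    by (auto simp: zero_groups_def)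
  define d where "d = norm (x k - xstar)"
  let ?w = "subvec (grad (batch_fun f (B k)) (x k)) g"
  let ?w' = "subvec (grad (batch_fun f (B k)) xstar) g"
  have a: "alpha k > 0" by (rule alpha)
  have B: "B k \<subseteq> {1..N}" "B k \<noteq> {}" "finite (B k)"
    using batches[of k] by (auto simp: minibatch_def intro: finite_subset)
  have L: "L \<ge> 0"
    using lipschitz[of 1] N by (auto intro: lipschitz_on_nonneg)

  have v: "norm (subvec (x k) g) \<le> d"
    using norm_subvec_le[of "x k - xstar" g] by (simp add: subvec_diff star d_def)
  have "norm (?w - ?w') \<le> L * d"
    unfolding d_def subvec_diff[symmetric]
    by (rule order_trans[OF norm_subvec_le grad_batch_fun_lipschitz])
       (use B differentiable lipschitz in auto)
  moreover have "norm ?w' \<le> lam - 2 * delta3"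
    using delta3(2) batches g by blast
  ultimately have w: "norm ?w \<le> lam - 2 * delta3 + L * d"
    using norm_triangle_sub[of ?w ?w'] by linarith
  have pos: "1 - eps + alpha k * L > 0"
    using eps(2) a L by (simp add: add_pos_nonneg)

  have sum: "(1 - eps) * norm (subvec (x k) g) + alpha k * norm ?w
      \<le> alpha k * lam + ((1 - eps + alpha k * L) * d - 2 * alpha k * delta3)"
    using mult_left_mono[OF v, of "1 - eps"] mult_left_mono[OF w, of "alpha k"] eps(2) a
    by (simp add: algebra_simps)
  have radius: "(1 - eps + alpha k * L) * d \<le> 2 * alpha k * delta3"
    using close pos by (simp add: d_def[symmetric] field_simps)
  have radius_strict: "(1 - eps + alpha k * L) * d < 2 * alpha k * delta3" if "eps > 0"
    using close not_tie[OF that] pos by (simp add: d_def[symmetric] field_simps)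

  have "half_space_step G lam f eps (alpha k) (B k) (x k) (x (Suc k))"
    using run k by (auto simp: hspg_def dest: spec[of _ k])
  then have "subvec (x (Suc k)) g = 0"
    by (rule half_space_step_zeroes_group[OF _ gG a eps(1)])
       (use sum radius radius_strict in linarith)+
  then show "g \<in> zero_groups G (x (Suc k))"
    using gG by (simp add: zero_groups_def)
qed

end
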